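(* Let $n,m\ge 2$. The grid $P_m \,\square\, P_n$ (Cartesian product of paths on $m$ and $n$ vertices) is a ${\cal D}$ graph for the Maker-Breaker total domination game if both $m$ and $n$ are even, and it is an ${\cal S}$ graph otherwise.
   Context: All graphs are finite and simple. The Maker-Breaker total domination (MBTD) game on a graph $G$ is played by Dominator and Staller, who alternately select a vertex of $G$ not selected before. Dominator wins if at some point the set of vertices he has selected is a total dominating set of $G$ (every vertex of $G$ has a neighbour in it); otherwise Staller wins, equivalently if she selects all vertices of the open neighbourhood of some vertex. The D-game is the game where Dominator moves first, the S-game where Staller moves first. A graph is ${\cal D}$ if Dominator has a winning strategy in both the D-game and the S-game, ${\cal S}$ if Staller has a winning strategy in both, and ${\cal N}$ if the first player has a winning strategy (Dominator wins the D-game and Staller wins the S-game), assuming optimal play. *)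

theory Defs
  imports Graph_Theory.Pair_Digraph
begin

text \<open>
  A finite simple graph is a \<^locale>\<open>pair_graph\<close>: every undirected edge is represented
  by its two arcs.
\<close>

definition path_graph :: "nat \<Rightarrow> nat pair_pre_digraph" where
  "path_graph n =
     \<lparr> pverts = {..<n},
       parcs = {(i, j). i < n \<and> j < n \<and> (j = Suc i \<or> i = Suc j)} \<rparr>"

definition cartesian_product ::
  "'a pair_pre_digraph \<Rightarrow> 'b pair_pre_digraph \<Rightarrow> ('a \<times> 'b) pair_pre_digraph" where
  "cartesian_product G H =
     \<lparr> pverts = pverts G \<times> pverts H,
       parcs = {((a, b), (a', b')).
                  (a = a' \<and> a \<in> pverts G \<and> (b, b') \<in> parcs H) \<or>
                  (b = b' \<and> b \<in> pverts H \<and> (a, a') \<in> parcs G)} \<rparr>"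

lemma pair_graph_path_graph: "pair_graph (path_graph n)"
proof (unfold_locales, goal_cases)
  case 4
  have "parcs (path_graph n) \<subseteq> {..<n} \<times> {..<n}"
    by (auto simp: path_graph_def)
  then show ?case by (rule finite_subset) simp
qed (auto simp: path_graph_def symmetric_def intro!: symI)

lemma pair_graph_cartesian_product:
  assumes "pair_graph G" "pair_graph H"
  shows "pair_graph (cartesian_product G H)"
proof -
  interpret G: pair_graph G by fact
  interpret H: pair_graph H by fact
  show ?thesis
  proof (unfold_locales, goal_cases)
    case 4
    have "parcs (cartesian_product G H) \<subseteq> (pverts G \<times> pverts H) \<times> (pverts G \<times> pverts H)"
      by (auto simp: cartesian_product_def dest: G.wellformed' H.wellformed')
    then show ?case by (rule finite_subset) simp
  qed (auto simp: cartesian_product_def symmetric_def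
        dest: G.wellformed' H.wellformed' G.no_loops' H.no_loops'
        intro!: symI intro: G.arcs_symmetric H.arcs_symmetric)
qed

definition total_dominating_set :: "'a pair_pre_digraph \<Rightarrow> 'a set \<Rightarrow> bool" where
  "total_dominating_set G X \<longleftrightarrow>
     X \<subseteq> pverts G \<and> (\<forall>v\<in>pverts G. \<exists>u\<in>X. (v, u) \<in> parcs G)"

datatype player = Dominator | Staller

fun opponent :: "player \<Rightarrow> player" where
  "opponent Dominator = Staller"
| "opponent Staller = Dominator"

text \<open>
  A position is the list of the vertices selected so far, oldest first. The games differ
  only in the player \<open>f\<close> who makes the first move (move number 0): \<open>f = Dominator\<close> is the
  D-game, \<open>f = Staller\<close> the S-game.
\<close>

definition mover :: "player \<Rightarrow> nat \<Rightarrow> player" where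
  "mover f i = (if even i then f else opponent f)"

definition mbtd_position :: "'a pair_pre_digraph \<Rightarrow> 'a list \<Rightarrow> bool" where
  "mbtd_position G h \<longleftrightarrow> distinct h \<and> set h \<subseteq> pverts G"

definition selected :: "player \<Rightarrow> player \<Rightarrow> 'a list \<Rightarrow> 'a set" where
  "selected f P h = {h ! i | i. i < length h \<and> mover f i = P}"

text \<open>
  A complete play continues until every vertex is selected; moves made after Dominator
  has obtained a total dominating set do not affect the outcome.
\<close>

definition complete_play :: "'a pair_pre_digraph \<Rightarrow> 'a list \<Rightarrow> bool" where
  "complete_play G h \<longleftrightarrow> distinct h \<and> set h = pverts G"

definition dominator_wins_play :: "'a pair_pre_digraph \<Rightarrow> player \<Rightarrow> 'a list \<Rightarrow> bool" where
  "dominator_wins_play G f h \<longleftrightarrow>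
     (\<exists>k\<le>length h. total_dominating_set G (selected f Dominator (take k h)))"

fun wins_play :: "'a pair_pre_digraph \<Rightarrow> player \<Rightarrow> player \<Rightarrow> 'a list \<Rightarrow> bool" where
  "wins_play G f Dominator h \<longleftrightarrow> dominator_wins_play G f h"
| "wins_play G f Staller h \<longleftrightarrow> \<not> dominator_wins_play G f h"

definition follows_strategy :: "player \<Rightarrow> player \<Rightarrow> ('a list \<Rightarrow> 'a) \<Rightarrow> 'a list \<Rightarrow> bool" where
  "follows_strategy f P \<sigma> h \<longleftrightarrow>
     (\<forall>i<length h. mover f i = P \<longrightarrow> h ! i = \<sigma> (take i h))"

text \<open>
  The first conjunct demands that \<open>\<sigma>\<close> prescribes a legal move in every position in which
  \<open>P\<close> has to move and that can be reached while \<open>P\<close> plays by \<open>\<sigma>\<close>. Hence such plays can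
  always be completed, and the second conjunct is not vacuous.
\<close>

definition winning_strategy ::
  "'a pair_pre_digraph \<Rightarrow> player \<Rightarrow> player \<Rightarrow> ('a list \<Rightarrow> 'a) \<Rightarrow> bool" where
  "winning_strategy G f P \<sigma> \<longleftrightarrow>
     (\<forall>h. mbtd_position G h \<and> \<not> complete_play G h \<and> mover f (length h) = P \<and>
          follows_strategy f P \<sigma> h \<longrightarrow> \<sigma> h \<in> pverts G - set h) \<and>
     (\<forall>h. complete_play G h \<and> follows_strategy f P \<sigma> h \<longrightarrow> wins_play G f P h)"

definition has_winning_strategy :: "'a pair_pre_digraph \<Rightarrow> player \<Rightarrow> player \<Rightarrow> bool" where
  "has_winning_strategy G f P \<longleftrightarrow> (\<exists>\<sigma>. winning_strategy G f P \<sigma>)"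

definition mbtd_D_graph :: "'a pair_pre_digraph \<Rightarrow> bool" where
  "mbtd_D_graph G \<longleftrightarrow>
     has_winning_strategy G Dominator Dominator \<and> has_winning_strategy G Staller Dominator"

definition mbtd_S_graph :: "'a pair_pre_digraph \<Rightarrow> bool" where
  "mbtd_S_graph G \<longleftrightarrow>
     has_winning_strategy G Dominator Staller \<and> has_winning_strategy G Staller Staller"

end

theory Submission
  imports Defs
begin

text \<open>
  If both sides are even, cut the grid into \<open>2 \<times> 2\<close> blocks and pair the diagonally opposite
  vertices of each block. Every vertex has one such pair inside its neighbourhood, so Dominator
  wins by always answering in the pair in which Staller has just moved.

  If \<open>m\<close> is odd, Staller can win inside the two outermost lines of length \<open>m\<close>, as long as
  Dominator has not played there: on the outermost line she plays the positions \<open>1, 3, 5, \<dots>\<close> in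
  turn. The move at \<open>2 i + 1\<close> threatens the neighbourhood of the vertex at \<open>2 i\<close> on that line,
  hence forces Dominator to the position \<open>2 i\<close> of the neighbouring line, and the last one
  threatens two neighbourhoods at once. No single first move of Dominator disturbs all the
  copies of this configuration along the sides of the grid.
\<close>

section \<open>Winning strategies from positional invariants\<close>

lemma selected_Nil [simp]: "selected f P [] = {}"
  by (simp add: selected_def)

lemma selected_snoc [simp]:
  "selected f P (h @ [v]) =
     (if mover f (length h) = P then insert v (selected f P h) else selected f P h)"
proof -
  have mem: "x \<in> selected f P k \<longleftrightarrow> (\<exists>i<length k. mover f i = P \<and> x = k ! i)" for x k
    unfolding selected_def by blast
  have "x \<in> selected f P (h @ [v]) \<longleftrightarrow> x \<in> selected f P h \<or> mover f (length h) = P \<and> x = v"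
    for x
  proof -
    have "(\<exists>i<length h. mover f i = P \<and> x = (h @ [v]) ! i) \<longleftrightarrow>
        (\<exists>i<length h. mover f i = P \<and> x = h ! i)"
      by (metis nth_append_left)
    then show ?thesis
      unfolding mem by (simp add: Ex_less_Suc) blast
  qed
  then show ?thesis by auto
qed

lemma opponent_neq [simp]: "opponent P \<noteq> P" "P \<noteq> opponent P"
  by (cases P; simp)+

lemma neq_iff_opponent: "Q \<noteq> P \<longleftrightarrow> Q = opponent P"
  by (cases P; cases Q; simp)

lemma mover_Suc: "mover f (Suc i) = opponent (mover f i)"
  by (cases f; simp add: mover_def)

lemma selected_Un: "selected f P h \<union> selected f (opponent P) h = set h"
proof (induction h rule: rev_induct)
  case (snoc v h)
  have "mover f (length h) = P \<or> mover f (length h) = opponent P"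
    using neq_iff_opponent by blast
  with snoc show ?case by auto
qed simp

lemma selected_Int:
  assumes "distinct h"
  shows "selected f P h \<inter> selected f (opponent P) h = {}"
  using assms
proof (induction h rule: rev_induct)
  case (snoc v h)
  have "v \<notin> selected f P h" "v \<notin> selected f (opponent P) h"
    using snoc.prems selected_Un[of f P h] by auto
  with snoc show ?case by simp
qed simp

lemma follows_strategy_snoc:
  "follows_strategy f P \<sigma> (h @ [v]) \<longleftrightarrow>
     follows_strategy f P \<sigma> h \<and> (mover f (length h) = P \<longrightarrow> v = \<sigma> h)"
  by (auto simp: follows_strategy_def nth_append less_Suc_eq)

lemma total_dominating_set_mono:
  "total_dominating_set G X \<Longrightarrow> X \<subseteq> Y \<Longrightarrow> Y \<subseteq> pverts G \<Longrightarrow> total_dominating_set G Y"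
  unfolding total_dominating_set_def by blast

text \<open>Dominator's set only grows and total domination survives adding vertices, so the
  quantifier over prefixes can be settled on the final position alone.\<close>

lemma dominator_wins_play_iff:
  assumes "set h \<subseteq> pverts G"
  shows "dominator_wins_play G f h \<longleftrightarrow> total_dominating_set G (selected f Dominator h)"
proof
  assume "dominator_wins_play G f h"
  then obtain k where k: "total_dominating_set G (selected f Dominator (take k h))"
    unfolding dominator_wins_play_def by blast
  have "selected f Dominator (take k h) \<subseteq> selected f Dominator h"
    by (auto simp: selected_def)
  moreover have "selected f Dominator h \<subseteq> pverts G"
    using selected_Un[of f Dominator h] assms by blast
  ultimately show "total_dominating_set G (selected f Dominator h)"
    by (rule total_dominating_set_mono[OF k])
next
  assume "total_dominating_set G (selected f Dominator h)"
  then show "dominator_wins_play G f h"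
    unfolding dominator_wins_play_def by (intro exI[of _ "length h"]) simp
qed

text \<open>
  \<open>I A B\<close> and \<open>J A B\<close> are the invariants for the positions where \<open>P\<close>, respectively the
  opponent, is to move; \<open>A\<close> and \<open>B\<close> are the sets selected by \<open>P\<close> and by the opponent.
\<close>

lemma has_winning_strategy_invariant:
  fixes G :: "'a pair_pre_digraph" and I J :: "'a set \<Rightarrow> 'a set \<Rightarrow> bool"
  assumes start: "if f = P then I {} {} else J {} {}"
    and own: "\<And>A B. I A B \<Longrightarrow> A \<inter> B = {} \<Longrightarrow> A \<union> B \<subset> pverts G \<Longrightarrow>
                 \<exists>v\<in>pverts G - (A \<union> B). J (insert v A) B"
    and opp: "\<And>A B v. J A B \<Longrightarrow> A \<inter> B = {} \<Longrightarrow> A \<union> B \<subseteq> pverts G \<Longrightarrow>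
                 v \<in> pverts G - (A \<union> B) \<Longrightarrow> I A (insert v B)"
    and fin: "\<And>A B. I A B \<or> J A B \<Longrightarrow> A \<inter> B = {} \<Longrightarrow> A \<union> B = pverts G \<Longrightarrow>
                 if P = Dominator then total_dominating_set G A
                 else \<not> total_dominating_set G B"
  shows "has_winning_strategy G f P"
proof -
  define own_set :: "'a list \<Rightarrow> 'a set" where "own_set = selected f P"
  define opp_set :: "'a list \<Rightarrow> 'a set" where "opp_set = selected f (opponent P)"
  \<comment> \<open>Any free vertex that re-establishes \<open>J\<close> will do. The choice depends
    only on the two sets selected, not on the order of the moves.\<close>
  define \<sigma> where
    "\<sigma> h = (SOME v. v \<in> pverts G - set h \<and> J (insert v (own_set h)) (opp_set h))" for h
  define Inv where "Inv h \<longleftrightarrow> (if mover f (length h) = P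
      then I (own_set h) (opp_set h) else J (own_set h) (opp_set h))" for h
  have un: "own_set h \<union> opp_set h = set h" for h
    by (simp add: own_set_def opp_set_def selected_Un)
  have int: "own_set h \<inter> opp_set h = {}" if "distinct h" for h
    using that by (simp add: own_set_def opp_set_def selected_Int)
  have \<sigma>: "\<sigma> h \<in> pverts G - set h \<and> J (insert (\<sigma> h) (own_set h)) (opp_set h)"
    if "Inv h" "distinct h" "set h \<subset> pverts G" "mover f (length h) = P" for h
  proof -
    have "I (own_set h) (opp_set h)" using that by (simp add: Inv_def)
    from own[OF this int[OF that(2)]]
    have "\<exists>v. v \<in> pverts G - set h \<and> J (insert v (own_set h)) (opp_set h)"
      unfolding un using that(3) by blast
    then show ?thesis unfolding \<sigma>_def by (rule someI_ex)
  qed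
  have Inv: "Inv h" if "distinct h" "set h \<subseteq> pverts G" "follows_strategy f P \<sigma> h" for h
    using that
  proof (induction h rule: rev_induct)
    case Nil
    then show ?case
      using start by (simp add: Inv_def own_set_def opp_set_def mover_def)
  next
    case (snoc v h)
    then have h: "Inv h" "distinct h" "set h \<subset> pverts G" "v \<in> pverts G - set h"
      by (auto simp: follows_strategy_snoc)
    show ?case
    proof (cases "mover f (length h) = P")
      case True
      then have "v = \<sigma> h" using snoc.prems(3) by (simp add: follows_strategy_snoc)
      then show ?thesis
        using \<sigma>[of h] h True by (simp add: Inv_def own_set_def opp_set_def mover_Suc)
    next
      case False
      then have "J (own_set h) (opp_set h)" using h by (simp add: Inv_def)
      then have "I (own_set h) (insert v (opp_set h))"
        by (rule opp[OF _ int[OF h(2)]]) (use h un[of h] in auto)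
      moreover have "mover f (length h) = opponent P" using False neq_iff_opponent by blast
      moreover have "opponent (opponent P) = P" by (cases P) auto
      ultimately show ?thesis
        by (simp add: Inv_def own_set_def opp_set_def mover_Suc)
    qed
  qed
  have "winning_strategy G f P \<sigma>"
    unfolding winning_strategy_def
  proof (intro conjI allI impI; elim conjE)
    fix h
    assume h: "mbtd_position G h" "\<not> complete_play G h" "mover f (length h) = P"
      "follows_strategy f P \<sigma> h"
    then show "\<sigma> h \<in> pverts G - set h"
      using \<sigma>[of h] Inv[of h] unfolding mbtd_position_def complete_play_def by blast
  next
    fix h
    assume h: "complete_play G h" "follows_strategy f P \<sigma> h"
    then have d: "distinct h" and s: "set h = pverts G"
      by (auto simp: complete_play_def)
    \<comment> \<open>On a full board either player may be due to move, depending on the parity of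
      the number of vertices, so either invariant may be the one that holds.\<close>
    have "I (own_set h) (opp_set h) \<or> J (own_set h) (opp_set h)"
      using Inv[of h] d s h(2) by (auto simp: Inv_def split: if_splits)
    from fin[OF this int[OF d]]
    have "if P = Dominator then total_dominating_set G (own_set h)
          else \<not> total_dominating_set G (opp_set h)"
      unfolding un s by blast
    then show "wins_play G f P h"
      using dominator_wins_play_iff[of h G f] s
      by (cases P) (simp_all add: own_set_def opp_set_def)
  qed
  then show ?thesis unfolding has_winning_strategy_def by blast
qed

section \<open>Pairing strategies for Dominator\<close>

text \<open>Answering each Staller move by its mate keeps her from holding a whole pair, and every
  neighbourhood contains a pair. Moving first does no harm, since an extra vertex never hurts
  Dominator.\<close>

lemma mbtd_D_graph_pairing:
  fixes G :: "'a pair_pre_digraph"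
  assumes mem: "\<And>u. u \<in> pverts G \<Longrightarrow> p u \<in> pverts G"
    and inv: "\<And>u. u \<in> pverts G \<Longrightarrow> p (p u) = u"
    and neq: "\<And>u. u \<in> pverts G \<Longrightarrow> p u \<noteq> u"
    and dom: "\<And>v. v \<in> pverts G \<Longrightarrow>
                \<exists>u\<in>pverts G. (v, u) \<in> parcs G \<and> (v, p u) \<in> parcs G"
  shows "mbtd_D_graph G"
proof -
  \<comment> \<open>After Dominator's move every Staller vertex is answered; before it at most one,
    \<open>w\<close>, may be open. The disjunct \<open>J A B\<close> in \<open>I\<close> admits the
    empty position without exhibiting a vertex \<open>w\<close>.\<close>
  define J where "J A B \<longleftrightarrow> (\<forall>u\<in>B. p u \<in> A)" for A B
  define I where "I A B \<longleftrightarrow> (\<exists>w\<in>pverts G. \<forall>u\<in>B - {w}. p u \<in> A) \<or> J A B" for A B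
  \<comment> \<open>A mate of \<open>w\<close> that is already selected is Dominator's: otherwise
    \<open>p w\<close> would be another Staller vertex, answered at \<open>p (p w) = w\<close>,
    which is hers.\<close>
  have pending: "p w \<in> A" if "\<forall>u\<in>B - {w}. p u \<in> A" "w \<in> B" "p w \<in> A \<union> B"
      "A \<inter> B = {}" "A \<union> B \<subseteq> pverts G" for A B w
  proof (rule ccontr)
    assume "p w \<notin> A"
    then have "p w \<in> B - {w}" using that neq by blast
    then have "p (p w) \<in> A" using that by blast
    moreover have "p (p w) = w" using inv that by blast
    ultimately show False using that by auto
  qed
  have "has_winning_strategy G f Dominator" for f
  proof (rule has_winning_strategy_invariant[where I = I and J = J])
    show "if f = Dominator then I {} {} else J {} {}"
      by (simp add: I_def J_def)
  next
    fix A B assume AB: "I A B" "A \<inter> B = {}" "A \<union> B \<subset> pverts G"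
    show "\<exists>v\<in>pverts G - (A \<union> B). J (insert v A) B"
    proof (cases "J A B")
      case True
      \<comment> \<open>Nothing is open, so an arbitrary free vertex is played; \<open>J\<close>
        survives enlarging \<open>A\<close>.\<close>
      then show ?thesis using AB(3) unfolding J_def by blast
    next
      case False
      then obtain w where w: "w \<in> pverts G" "\<forall>u\<in>B - {w}. p u \<in> A"
        using AB(1) unfolding I_def by blast
      then have "w \<in> B" "p w \<notin> A" using False unfolding J_def by blast+
      then have "p w \<notin> A \<union> B" using pending[OF w(2)] AB by blast
      moreover have "J (insert (p w) A) B" using w(2) unfolding J_def by blast
      ultimately show ?thesis using mem[OF w(1)] by blast
    qed
  next
    fix A B v assume "J A B" "v \<in> pverts G - (A \<union> B)"
    then show "I A (insert v B)" unfolding I_def J_def by blast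
  next
    fix A B assume AB: "I A B \<or> J A B" "A \<inter> B = {}" "A \<union> B = pverts G"
    \<comment> \<open>No mate is free on a full board, so even the possible exception
      \<open>w\<close> is answered.\<close>
    have J: "p u \<in> A" if "u \<in> B" for u
    proof -
      obtain w where "\<forall>u\<in>B - {w}. p u \<in> A"
        using AB(1) unfolding I_def J_def by blast
      moreover have "p u \<in> A \<union> B" using AB(3) mem that by blast
      ultimately show ?thesis
        using pending[of B w A] AB that by (cases "u = w") auto
    qed
    have "\<exists>u\<in>A. (v, u) \<in> parcs G" if v: "v \<in> pverts G" for v
      using dom[OF v] J AB(3) by blast
    then show "if Dominator = Dominator then total_dominating_set G A
               else \<not> total_dominating_set G B"
      using AB(3) by (auto simp: total_dominating_set_def)
  qed
  then show ?thesis by (simp add: mbtd_D_graph_def)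
qed

section \<open>Forcing strategies for Staller\<close>

text \<open>
  Staller plays \<open>x 0, \<dots>, x (k - 1)\<close>; after \<open>x i\<close> Dominator has to answer \<open>y i\<close>, the last free
  neighbour of \<open>c i\<close>, and after \<open>x (k - 1)\<close> he would need both \<open>y (k - 1)\<close> and \<open>y k\<close>.
\<close>

definition forcing_comb ::
  "'a pair_pre_digraph \<Rightarrow> nat \<Rightarrow> (nat \<Rightarrow> 'a) \<Rightarrow> (nat \<Rightarrow> 'a) \<Rightarrow> (nat \<Rightarrow> 'a) \<Rightarrow> bool" where
  "forcing_comb G k x y c \<longleftrightarrow>
     inj_on x {..<k} \<and> inj_on y {..k} \<and> x ` {..<k} \<inter> y ` {..k} = {} \<and>
     x ` {..<k} \<subseteq> pverts G \<and> y ` {..k} \<subseteq> pverts G \<and> c ` {..k} \<subseteq> pverts G \<and>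
     (\<forall>i\<le>k. \<forall>u. (c i, u) \<in> parcs G \<longrightarrow>
        u = y i \<or> (i < k \<and> u = x i) \<or> (0 < i \<and> u = x (i - 1)))"

lemma forcing_combD:
  assumes "forcing_comb G k x y c"
  shows "\<And>i j. i < k \<Longrightarrow> j < k \<Longrightarrow> x i = x j \<Longrightarrow> i = j"
    and "\<And>i j. i \<le> k \<Longrightarrow> j \<le> k \<Longrightarrow> y i = y j \<Longrightarrow> i = j"
    and "\<And>i j. i < k \<Longrightarrow> j \<le> k \<Longrightarrow> x i \<noteq> y j"
    and "\<And>i. i < k \<Longrightarrow> x i \<in> pverts G"
    and "\<And>i. i \<le> k \<Longrightarrow> y i \<in> pverts G"
    and "\<And>i. i \<le> k \<Longrightarrow> c i \<in> pverts G"
    and "\<And>i u. i \<le> k \<Longrightarrow> (c i, u) \<in> parcs G \<Longrightarrow>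
           u = y i \<or> (i < k \<and> u = x i) \<or> (0 < i \<and> u = x (i - 1))"
proof -
  have "inj_on x {..<k}" "inj_on y {..k}" and disj: "x ` {..<k} \<inter> y ` {..k} = {}"
    and "x ` {..<k} \<subseteq> pverts G" "y ` {..k} \<subseteq> pverts G" "c ` {..k} \<subseteq> pverts G"
    using assms by (simp_all only: forcing_comb_def)
  then show "\<And>i j. i < k \<Longrightarrow> j < k \<Longrightarrow> x i = x j \<Longrightarrow> i = j"
    and "\<And>i j. i \<le> k \<Longrightarrow> j \<le> k \<Longrightarrow> y i = y j \<Longrightarrow> i = j"
    and "\<And>i. i < k \<Longrightarrow> x i \<in> pverts G"
    and "\<And>i. i \<le> k \<Longrightarrow> y i \<in> pverts G"
    and "\<And>i. i \<le> k \<Longrightarrow> c i \<in> pverts G"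
    by (simp_all add: inj_on_def image_subset_iff)
  show "x i \<noteq> y j" if "i < k" "j \<le> k" for i j
  proof -
    have "x i \<in> x ` {..<k}" "y j \<in> y ` {..k}" using that by simp_all
    then show ?thesis using disj by (metis disjoint_iff)
  qed
  show "\<And>i u. i \<le> k \<Longrightarrow> (c i, u) \<in> parcs G \<Longrightarrow>
           u = y i \<or> (i < k \<and> u = x i) \<or> (0 < i \<and> u = x (i - 1))"
    using assms by (simp only: forcing_comb_def)
qed

text \<open>The avoidance hypothesis serves the D-game: Dominator's opening move misses some comb,
  and Staller plays on that one. In the S-game she may start on any comb.\<close>

lemma mbtd_S_graph_forcing_combs:
  fixes G :: "'a pair_pre_digraph"
  assumes ne: "pverts G \<noteq> {}"
    and avoid: "\<And>u. u \<in> pverts G \<Longrightarrow>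
      \<exists>k x y c. forcing_comb G k x y c \<and> u \<notin> x ` {..<k} \<union> y ` {..k}"
  shows "mbtd_S_graph G"
proof -
  define won where "won A \<longleftrightarrow> (\<exists>v\<in>pverts G. \<forall>u. (v, u) \<in> parcs G \<longrightarrow> u \<in> A)" for A
  define threat where
    "threat A B \<longleftrightarrow> (\<exists>z\<in>pverts G - (A \<union> B). won (insert z A))" for A B
  \<comment> \<open>In \<open>ready\<close> Staller is about to play \<open>x i\<close>, or the
    final \<open>y k\<close> if \<open>i = k\<close>; \<open>waiting\<close> is the position just
    after \<open>x i\<close>. Earlier \<open>y j\<close> are unconstrained because those threats
    have been met.\<close>
  define ready where "ready A B \<longleftrightarrow> (\<exists>k x y c i. forcing_comb G k x y c \<and> i \<le> k \<and>
      (\<forall>j<i. x j \<in> A) \<and> (\<forall>j\<in>{i..<k}. x j \<notin> A \<union> B) \<and> (\<forall>j\<in>{i..k}. y j \<notin> A \<union> B))" for A B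
  define waiting where "waiting A B \<longleftrightarrow> (\<exists>k x y c i. forcing_comb G k x y c \<and> i < k \<and>
      (\<forall>j\<le>i. x j \<in> A) \<and> (\<forall>j\<in>{Suc i..<k}. x j \<notin> A \<union> B) \<and> (\<forall>j\<in>{i..k}. y j \<notin> A \<union> B))"
    for A B
  define I where "I A B \<longleftrightarrow> won A \<or> threat A B \<or> ready A B" for A B
  \<comment> \<open>The empty board is the opening of the D-game, before Staller commits to a
    comb.\<close>
  define J where "J A B \<longleftrightarrow> won A \<or> waiting A B \<or> A \<union> B = {}" for A B
  have won_mono: "won A'" if "won A" "A \<subseteq> A'" for A A'
    using that unfolding won_def by blast
  have comb_won: "won A" if "forcing_comb G k x y c" "i \<le> k" "y i \<in> A"
      "i < k \<Longrightarrow> x i \<in> A" "0 < i \<Longrightarrow> x (i - 1) \<in> A" for A k x y c i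
  proof -
    have "u \<in> A" if "(c i, u) \<in> parcs G" for u
      using forcing_combD(7)[OF \<open>forcing_comb G k x y c\<close> \<open>i \<le> k\<close> that]
        \<open>y i \<in> A\<close> \<open>i < k \<Longrightarrow> x i \<in> A\<close> \<open>0 < i \<Longrightarrow> x (i - 1) \<in> A\<close>
      by auto
    then show ?thesis
      using forcing_combD(6)[OF \<open>forcing_comb G k x y c\<close> \<open>i \<le> k\<close>] unfolding won_def by blast
  qed
  have "has_winning_strategy G f Staller" for f
  proof (rule has_winning_strategy_invariant[where I = I and J = J])
    from ne obtain u where "u \<in> pverts G" by blast
    with avoid obtain k x y c where "forcing_comb G k x y c" by blast
    then have "ready {} {}"
      unfolding ready_def
      by (intro exI[of _ k] exI[of _ x] exI[of _ y] exI[of _ c] exI[of _ 0]) simp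
    then show "if f = Staller then I {} {} else J {} {}"
      by (simp add: I_def J_def)
  next
    fix A B assume AB: "I A B" "A \<inter> B = {}" "A \<union> B \<subset> pverts G"
    from AB(1) consider "won A" | "threat A B" | "ready A B" by (auto simp: I_def)
    then show "\<exists>v\<in>pverts G - (A \<union> B). J (insert v A) B"
    proof cases
      case 1
      then show ?thesis using AB(3) won_mono[of A] unfolding J_def by blast
    next
      case 2
      then show ?thesis unfolding threat_def J_def by blast
    next
      case 3
      then obtain k x y c i where comb: "forcing_comb G k x y c" and i: "i \<le> k"
        and xA: "\<forall>j<i. x j \<in> A" and x_free: "\<forall>j\<in>{i..<k}. x j \<notin> A \<union> B"
        and y_free: "\<forall>j\<in>{i..k}. y j \<notin> A \<union> B"
        unfolding ready_def by blast
      show ?thesis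
      proof (cases "i = k")
        \<comment> \<open>All of \<open>x\<close> is played and \<open>c k\<close> has no neighbour
          beyond \<open>x (k - 1)\<close> and \<open>y k\<close>, so \<open>y k\<close> completes
          its neighbourhood: for \<open>k > 0\<close>, the second half of the double threat.\<close>
        case True
        have "won (insert (y k) A)"
          by (rule comb_won[OF comb, of k]) (use xA True in auto)
        moreover have "y k \<in> pverts G - (A \<union> B)"
          using forcing_combD(5)[OF comb, of k] y_free True by simp
        ultimately show ?thesis unfolding J_def by blast
      next
        case False
        then have "i < k" using i by simp
        have "x i \<in> pverts G - (A \<union> B)"
          using forcing_combD(4)[OF comb \<open>i < k\<close>] x_free \<open>i < k\<close> by simp
        moreover have "waiting (insert (x i) A) B"
          unfolding waiting_def
        proof (intro exI conjI)
          show "forcing_comb G k x y c" "i < k" by fact+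
          show "\<forall>j\<le>i. x j \<in> insert (x i) A" using xA by (auto simp: le_less)
          show "\<forall>j\<in>{Suc i..<k}. x j \<notin> insert (x i) A \<union> B"
          proof
            fix j assume "j \<in> {Suc i..<k}"
            then show "x j \<notin> insert (x i) A \<union> B"
              using forcing_combD(1)[OF comb, of j i] x_free by auto
          qed
          show "\<forall>j\<in>{i..k}. y j \<notin> insert (x i) A \<union> B"
          proof
            fix j assume "j \<in> {i..k}"
            then show "y j \<notin> insert (x i) A \<union> B"
              using forcing_combD(3)[OF comb \<open>i < k\<close>, of j] y_free by auto
          qed
        qed
        ultimately show ?thesis unfolding J_def by blast
      qed
    qed
  next
    fix A B v
    assume AB: "J A B" "A \<inter> B = {}" "A \<union> B \<subseteq> pverts G" and v: "v \<in> pverts G - (A \<union> B)"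
    from AB(1) consider "won A" | "waiting A B" | "A \<union> B = {}" by (auto simp: J_def)
    then show "I A (insert v B)"
    proof cases
      case 1
      then show ?thesis by (simp add: I_def)
    next
      case 2
      then obtain k x y c i where comb: "forcing_comb G k x y c" and i: "i < k"
        and xA: "\<forall>j\<le>i. x j \<in> A" and x_free: "\<forall>j\<in>{Suc i..<k}. x j \<notin> A \<union> B"
        and y_free: "\<forall>j\<in>{i..k}. y j \<notin> A \<union> B"
        unfolding waiting_def by blast
      show ?thesis
      proof (cases "v = y i")
        \<comment> \<open>Dominator met the threat at \<open>c i\<close>; the comb advances and
          \<open>y i\<close> leaves the vertices required to be free.\<close>
        case True
        have "ready A (insert v B)"
          unfolding ready_def
        proof (intro exI conjI)
          show "forcing_comb G k x y c" by fact
          show "Suc i \<le> k" using i by simp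
          show "\<forall>j<Suc i. x j \<in> A" using xA by simp
          show "\<forall>j\<in>{Suc i..<k}. x j \<notin> A \<union> insert v B"
          proof
            fix j assume "j \<in> {Suc i..<k}"
            then show "x j \<notin> A \<union> insert v B"
              using forcing_combD(3)[OF comb, of j i] x_free i True by auto
          qed
          show "\<forall>j\<in>{Suc i..k}. y j \<notin> A \<union> insert v B"
          proof
            fix j assume "j \<in> {Suc i..k}"
            then show "y j \<notin> A \<union> insert v B"
              using forcing_combD(2)[OF comb, of j i] y_free i True by auto
          qed
        qed
        then show ?thesis by (simp add: I_def)
      next
        \<comment> \<open>Dominator left \<open>y i\<close> free, while the other neighbours of
          \<open>c i\<close> are already Staller's.\<close>
        case False
        have "won (insert (y i) A)"
          by (rule comb_won[OF comb, of i]) (use xA i in auto)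
        moreover have "y i \<in> pverts G - (A \<union> insert v B)"
          using forcing_combD(5)[OF comb, of i] y_free i False by simp
        ultimately show ?thesis unfolding I_def threat_def by blast
      qed
    next
      case 3
      obtain k x y c where comb: "forcing_comb G k x y c" and "v \<notin> x ` {..<k} \<union> y ` {..k}"
        using avoid v by blast
      then have "ready A (insert v B)"
        unfolding ready_def using 3
        by (intro exI[of _ k] exI[of _ x] exI[of _ y] exI[of _ c] exI[of _ 0]) auto
      then show ?thesis by (simp add: I_def)
    qed
  next
    fix A B assume AB: "I A B \<or> J A B" "A \<inter> B = {}" "A \<union> B = pverts G"
    \<comment> \<open>\<open>threat\<close>, \<open>ready\<close> and \<open>waiting\<close> each
      need a free vertex, so on a full board only \<open>won A\<close> remains.\<close>
    have "\<not> threat A B" using AB(3) by (simp add: threat_def)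
    moreover have "\<not> ready A B"
    proof
      assume "ready A B"
      then obtain k x y c i where "forcing_comb G k x y c" "i \<le> k"
        "\<forall>j\<in>{i..k}. y j \<notin> pverts G"
        unfolding ready_def AB(3) by blast
      then show False using forcing_combD(5)[of G k x y c i] by simp
    qed
    moreover have "\<not> waiting A B"
    proof
      assume "waiting A B"
      then obtain k x y c i where "forcing_comb G k x y c" "i < k"
        "\<forall>j\<in>{i..k}. y j \<notin> pverts G"
        unfolding waiting_def AB(3) by blast
      then show False using forcing_combD(5)[of G k x y c i] by simp
    qed
    ultimately have "won A" using AB(1,3) ne by (auto simp: I_def J_def)
    then have "\<not> total_dominating_set G B"
      using AB(2) unfolding won_def total_dominating_set_def by blast
    then show "if Staller = Dominator then total_dominating_set G A
               else \<not> total_dominating_set G B" by simp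
  qed
  then show ?thesis by (simp add: mbtd_S_graph_def)
qed

section \<open>Grids\<close>

lemma pverts_grid:
  "pverts (cartesian_product (path_graph m) (path_graph n)) = {..<m} \<times> {..<n}"
  by (simp add: cartesian_product_def path_graph_def)

lemma parcs_grid:
  "((a, b), (a', b')) \<in> parcs (cartesian_product (path_graph m) (path_graph n)) \<longleftrightarrow>
     a < m \<and> b < n \<and> a' < m \<and> b' < n \<and>
     (a = a' \<and> (b' = Suc b \<or> b = Suc b') \<or> b = b' \<and> (a' = Suc a \<or> a = Suc a'))"
  by (auto simp: cartesian_product_def path_graph_def)

section \<open>Both sides even: diagonals of 2 x 2 blocks\<close>

definition block_mate :: "nat \<Rightarrow> nat" where
  "block_mate i = (if even i then Suc i else i - 1)"

lemma block_mate_simps [simp]: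
  "block_mate (block_mate i) = i" "block_mate i \<noteq> i"
  by (cases i; simp add: block_mate_def)+

text \<open>Evenness of \<open>n\<close> keeps the last index from being paired with
  \<open>n\<close> itself.\<close>

lemma block_mate_less: "even n \<Longrightarrow> i < n \<Longrightarrow> block_mate i < n"
  by (cases "Suc i = n") (auto simp: block_mate_def)

lemma block_mate_cases: "block_mate i = Suc i \<or> i = Suc (block_mate i)"
  by (cases i) (simp_all add: block_mate_def)

lemma grid_even_even:
  assumes "even m" "even n"
  shows "mbtd_D_graph (cartesian_product (path_graph m) (path_graph n))"
proof (rule mbtd_D_graph_pairing[where p = "map_prod block_mate block_mate"])
  let ?G = "cartesian_product (path_graph m) (path_graph n)"
  fix u assume "u \<in> pverts ?G"
  then obtain a b where u: "u = (a, b)" and less: "a < m" "b < n" by (auto simp: pverts_grid)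
  have mate_less: "block_mate a < m" "block_mate b < n"
    using block_mate_less assms less by blast+
  show "map_prod block_mate block_mate u \<in> pverts ?G"
    "map_prod block_mate block_mate (map_prod block_mate block_mate u) = u"
    "map_prod block_mate block_mate u \<noteq> u"
    using mate_less by (simp_all add: u pverts_grid)
  show "\<exists>w\<in>pverts ?G. (u, w) \<in> parcs ?G \<and> (u, map_prod block_mate block_mate w) \<in> parcs ?G"
  proof
    \<comment> \<open>The neighbours of \<open>(a, b)\<close> inside its block form the other
      diagonal, hence are each other's mates.\<close>
    show "(u, (block_mate a, b)) \<in> parcs ?G \<and>
        (u, map_prod block_mate block_mate (block_mate a, b)) \<in> parcs ?G"
      using less mate_less block_mate_cases[of a] block_mate_cases[of b]
      by (simp add: u parcs_grid)
    show "(block_mate a, b) \<in> pverts ?G"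
      using less mate_less by (simp add: pverts_grid)
  qed
qed

section \<open>An odd side: combs along boundary lines\<close>

text \<open>\<open>leaf\<close> makes \<open>a\<close> an endpoint of its path with sole neighbour
  \<open>b\<close>. As \<open>m\<close> is odd, both ends of the line, \<open>0\<close> and
  \<open>m - 1 = 2 * (m div 2)\<close>, are even and so are centres \<open>c i\<close>; there the
  line has no further vertex, which opens and closes the chain of threats.\<close>

lemma grid_forcing_comb:
  assumes "odd m" "a < n" "b < n"
    and leaf: "\<And>j. j < n \<Longrightarrow> j = Suc a \<or> a = Suc j \<Longrightarrow> j = b" and "a \<noteq> b"
  shows "forcing_comb (cartesian_product (path_graph m) (path_graph n)) (m div 2)
           (\<lambda>i. (2 * i + 1, a)) (\<lambda>i. (2 * i, b)) (\<lambda>i. (2 * i, a))"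
proof -
  have m: "m = 2 * (m div 2) + 1" using assms(1) by simp
  show ?thesis
    unfolding forcing_comb_def
  proof (intro conjI allI impI)
    show "(\<lambda>i. (2 * i + 1, a)) ` {..<m div 2} \<inter> (\<lambda>i. (2 * i, b)) ` {..m div 2} = {}"
      using \<open>a \<noteq> b\<close> by auto
    have "2 * i + 1 < m" if "i < m div 2" for i using that m by linarith
    then show "(\<lambda>i. (2 * i + 1, a)) ` {..<m div 2}
        \<subseteq> pverts (cartesian_product (path_graph m) (path_graph n))"
      using assms(2,3) by (auto simp: pverts_grid)
    have less: "2 * i < m" if "i \<le> m div 2" for i using that m by linarith
    then show "(\<lambda>i. (2 * i, b)) ` {..m div 2}
        \<subseteq> pverts (cartesian_product (path_graph m) (path_graph n))"
      "(\<lambda>i. (2 * i, a)) ` {..m div 2}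
        \<subseteq> pverts (cartesian_product (path_graph m) (path_graph n))"
      using assms(2,3) by (auto simp: pverts_grid)
  next
    fix i u
    assume arc: "((2 * i, a), u) \<in> parcs (cartesian_product (path_graph m) (path_graph n))"
    obtain p q where u: "u = (p, q)" by (cases u)
    \<comment> \<open>The neighbour off the line, the next and the previous one. The bound
      \<open>p < m\<close> gives \<open>i < m div 2\<close>, and a predecessor forces
      \<open>0 < i\<close>.\<close>
    consider "p = 2 * i" "q = b" | "q = a" "p = Suc (2 * i)" "p < m" | "q = a" "2 * i = Suc p"
      using arc leaf unfolding u parcs_grid by blast
    then show "u = (2 * i, b) \<or> i < m div 2 \<and> u = (2 * i + 1, a) \<or>
        0 < i \<and> u = (2 * (i - 1) + 1, a)"
    proof cases
      case 2
      then have "i < m div 2" using m by linarith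
      then show ?thesis using 2 u by simp
    next
      case 3
      then have "0 < i" "p = 2 * (i - 1) + 1" by presburger+
      then show ?thesis using 3 u by simp
    qed (simp add: u)
  qed (auto simp: inj_on_def)
qed

text \<open>Transposing the grid supplies combs in the second coordinate;
  \<open>grid_forcing_comb\<close> builds only those running in the first.\<close>

lemma forcing_comb_swap:
  assumes "forcing_comb (cartesian_product G H) k x y c"
  shows "forcing_comb (cartesian_product H G) k
           (\<lambda>i. prod.swap (x i)) (\<lambda>i. prod.swap (y i)) (\<lambda>i. prod.swap (c i))"
proof -
  note D = forcing_combD[OF assms]
  have verts: "prod.swap v \<in> pverts (cartesian_product H G)"
    if "v \<in> pverts (cartesian_product G H)" for v
    using that by (cases v) (auto simp: cartesian_product_def)
  have arcs: "(v, prod.swap u) \<in> parcs (cartesian_product G H)"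
    if "(prod.swap v, u) \<in> parcs (cartesian_product H G)" for u v
    using that by (cases u; cases v) (auto simp: cartesian_product_def)
  have eq: "u = prod.swap v" if "prod.swap u = v" for u :: "'b \<times> 'a" and v
    using that by auto
  show ?thesis
    unfolding forcing_comb_def
  proof (intro conjI allI impI)
    show "inj_on (\<lambda>i. prod.swap (x i)) {..<k}"
      using D(1) by (intro inj_onI) (metis lessThan_iff swap_swap)
    show "inj_on (\<lambda>i. prod.swap (y i)) {..k}"
      using D(2) by (intro inj_onI) (metis atMost_iff swap_swap)
    show "(\<lambda>i. prod.swap (x i)) ` {..<k} \<inter> (\<lambda>i. prod.swap (y i)) ` {..k} = {}"
      using D(3) by (force simp: prod.swap_def prod_eq_iff)
  next
    fix i u
    assume i: "i \<le> k" and u: "(prod.swap (c i), u) \<in> parcs (cartesian_product H G)"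
    from D(7)[OF i arcs[OF u]] eq
    show "u = prod.swap (y i) \<or> i < k \<and> u = prod.swap (x i) \<or> 0 < i \<and> u = prod.swap (x (i - 1))"
      by blast
  qed (use D(4-6) verts in blast)+
qed

text \<open>The combs on two opposite sides are disjoint unless \<open>n = 3\<close>, when both use
  the even positions of the middle line. A vertex there is avoided by a crosswise comb, available
  because 3 is odd.\<close>

lemma grid_odd:
  assumes "odd m" "m \<ge> 2" "n \<ge> 2"
  shows "\<exists>k x y c. forcing_comb (cartesian_product (path_graph m) (path_graph n)) k x y c \<and>
           (p, q) \<notin> x ` {..<k} \<union> y ` {..k}"
proof -
  let ?G = "cartesian_product (path_graph m) (path_graph n)"
  have low: "forcing_comb ?G (m div 2)
      (\<lambda>i. (2 * i + 1, 0)) (\<lambda>i. (2 * i, 1)) (\<lambda>i. (2 * i, 0))"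
    by (rule grid_forcing_comb) (use assms in auto)
  have high: "forcing_comb ?G (m div 2)
      (\<lambda>i. (2 * i + 1, n - 1)) (\<lambda>i. (2 * i, n - 2)) (\<lambda>i. (2 * i, n - 1))"
    by (rule grid_forcing_comb) (use assms in auto)
  consider "odd p \<and> q \<noteq> 0 \<or> even p \<and> q \<noteq> 1" | "odd p \<and> q \<noteq> n - 1 \<or> even p \<and> q \<noteq> n - 2"
    | "even p" "q = 1" "n = 3"
    using assms(3) by (cases "even p"; cases "q = 1"; cases "n = 3"; simp; linarith)
  then show ?thesis
  proof cases
    case 1
    then have "(p, q) \<notin> (\<lambda>i. (2 * i + 1, 0)) ` {..<m div 2} \<union> (\<lambda>i. (2 * i, 1)) ` {..m div 2}"
      by auto
    with low show ?thesis by blast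
  next
    case 2
    then have "(p, q) \<notin> (\<lambda>i. (2 * i + 1, n - 1)) ` {..<m div 2} \<union>
        (\<lambda>i. (2 * i, n - 2)) ` {..m div 2}"
      by auto
    with high show ?thesis by blast
  next
    case 3
    have left: "forcing_comb ?G (n div 2) (\<lambda>i. prod.swap (2 * i + 1, 0))
        (\<lambda>i. prod.swap (2 * i, 1)) (\<lambda>i. prod.swap (2 * i, 0))"
      by (rule forcing_comb_swap, rule grid_forcing_comb) (use assms 3 in auto)
    have right: "forcing_comb ?G (n div 2) (\<lambda>i. prod.swap (2 * i + 1, m - 1))
        (\<lambda>i. prod.swap (2 * i, m - 2)) (\<lambda>i. prod.swap (2 * i, m - 1))"
      by (rule forcing_comb_swap, rule grid_forcing_comb) (use assms 3 in auto)
    \<comment> \<open>Since \<open>q = 1\<close> and all \<open>y\<close> have even second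
      coordinate, only the single \<open>x\<close> can collide: \<open>(0, 1)\<close> on the left,
      \<open>(m - 1, 1)\<close> on the right. These differ, so one comb avoids
      \<open>(p, 1)\<close>.\<close>
    show ?thesis
    proof (cases "p = 0")
      case True
      then have "(p, q) \<notin> (\<lambda>i. prod.swap (2 * i + 1, m - 1)) ` {..<n div 2} \<union>
          (\<lambda>i. prod.swap (2 * i, m - 2)) ` {..n div 2}"
        unfolding True 3(2) using assms(2) by auto
      with right show ?thesis by blast
    next
      case False
      then have "(p, q) \<notin> (\<lambda>i. prod.swap (2 * i + 1, 0)) ` {..<n div 2} \<union>
          (\<lambda>i. prod.swap (2 * i, 1)) ` {..n div 2}"
        using False 3(1) by auto
      with left show ?thesis by blast
    qed
  qed
qed

theorem theorem4p2:
  fixes m n :: nat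
  assumes "n \<ge> 2" and "m \<ge> 2"
  shows "(even m \<and> even n \<longrightarrow>
            mbtd_D_graph (cartesian_product (path_graph m) (path_graph n))) \<and>
         (\<not> (even m \<and> even n) \<longrightarrow>
            mbtd_S_graph (cartesian_product (path_graph m) (path_graph n)))"
proof (intro conjI impI)
  assume "\<not> (even m \<and> even n)"
  then have odd: "odd m \<or> odd n" by blast
  show "mbtd_S_graph (cartesian_product (path_graph m) (path_graph n))"
  proof (rule mbtd_S_graph_forcing_combs)
    show "pverts (cartesian_product (path_graph m) (path_graph n)) \<noteq> {}"
      using assms by (simp add: pverts_grid lessThan_empty_iff)
  next
    fix u :: "nat \<times> nat"
    obtain p q where u: "u = (p, q)" by (cases u)
    show "\<exists>k x y c. forcing_comb (cartesian_product (path_graph m) (path_graph n)) k x y c \<and>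
            u \<notin> x ` {..<k} \<union> y ` {..k}"
      using odd
    proof
      assume "odd m"
      then show ?thesis unfolding u using assms by (intro grid_odd)
    next
      \<comment> \<open>A comb avoiding \<open>(q, p)\<close> is found in the transposed grid and
        reflected back.\<close>
      assume "odd n"
      then obtain k x y c
        where comb: "forcing_comb (cartesian_product (path_graph n) (path_graph m)) k x y c"
          and qp: "(q, p) \<notin> x ` {..<k} \<union> y ` {..k}"
        using grid_odd[of n m q p] assms by blast
      have "(p, q) \<notin> (\<lambda>i. prod.swap (x i)) ` {..<k} \<union> (\<lambda>i. prod.swap (y i)) ` {..k}"
        using qp by (auto simp: prod.swap_def image_iff prod_eq_iff)
      with forcing_comb_swap[OF comb] show ?thesis unfolding u by blast
    qed
  qed
qed (use grid_even_even in blast)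

end
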